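(* Let $X$ be a Banach space, $B$ an admissible Banach sequence space over $\mathbb{Z}$, and $(A_m)_{m\in\mathbb{Z}}$ a sequence of bounded linear operators on $X$ admitting a partial exponential dichotomy with projections $P_n^i$ and constants $D,b,d>0$. Let $f_n\colon X\to X$, $n\in\mathbb{Z}$, be maps for which there is $c>0$ such that $\|f_n(x)-f_n(y)\|\le c\|x-y\|$ for all $n\in\mathbb{Z}$ and $x,y\in X$, and put $F_n:=A_n+f_n$. Let $G\colon X_B\to X_B$ be the operator $G\mathbf{x}=-\mathbf{x}^c+\mathbb{A}^{s,u}\mathbf{x}^{s,u}$, and let $\|G\|$ be its operator norm with respect to the norm $\|\cdot\|_B'$ on $X_B$. Assume that $$4cD(1+2D)\|G\|<1.$$ Then the system $x_{n+1}=F_n(x_n)$, $n\in\mathbb{Z}$, has the $B$-Lipschitz quasi-shadowing property.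
   Context: Admissible Banach sequence spaces. Let $\mathcal{S}(\mathbb{Z})$ be the set of all real sequences $\mathbf{s}=(s_n)_{n\in\mathbb{Z}}$. A linear subspace $B\subset\mathcal{S}(\mathbb{Z})$ with a norm $\|\cdot\|_B$ is a Banach sequence space if it is complete and whenever $(s_n')_n\in B$ and $|s_n|\le|s_n'|$ for all $n$, then $\mathbf{s}=(s_n)_n\in B$ and $\|\mathbf{s}\|_B\le\|\mathbf{s}'\|_B$. It is admissible if (1) $\chi_{\{n\}}\in B$ and $\|\chi_{\{n\}}\|_B>0$ for all $n\in\mathbb{Z}$ ($\chi$ denotes the characteristic function), and (2) for every $\mathbf{s}\in B$ and $m\in\mathbb{Z}$ the shifted sequence $(s_{n+m})_n$ belongs to $B$ and has the same norm as $\mathbf{s}$. It is assumed throughout that $\|\chi_{\{0\}}\|_B=1$. The space $X_B$. $X_B:=\{\mathbf{x}=(x_n)_{n\in\mathbb{Z}}\subset X:(\|x_n\|)_n\in B\}$ with norm $\|\mathbf{x}\|_B:=\|(\|x_n\|)_n\|_B$; this is a Banach space. Partial exponential dichotomy. For $m>n$ put $\mathcal{A}(m,n)=A_{m-1}\cdots A_n$, and $\mathcal{A}(n,n)=\mathrm{Id}$. The sequence $(A_m)_{m\in\mathbb{Z}}$ admits a partial exponential dichotomy if there are projections $P_n^i$ ($n\in\mathbb{Z}$, $i\in\{1,2,3\}$) on $X$ with $P_n^1+P_n^2+P_n^3=\mathrm{Id}$ and $A_nP_n^i=P_{n+1}^iA_n$, such that $A_n|_{\operatorname{Im}P_n^2}\colon\operatorname{Im}P_n^2\to\operatorname{Im}P_{n+1}^2$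 is invertible for all $n$, and constants $D,b,d>0$ with $\|\mathcal{A}(m,n)P_n^1\|\le De^{-d(m-n)}$ for $m\ge n$ and $\|\mathcal{A}(m,n)P_n^2\|\le De^{-b(n-m)}$ for $m\le n$, where for $m<n$ one sets $\mathcal{A}(m,n)=(\mathcal{A}(n,m)|_{\operatorname{Im}P_m^2})^{-1}\colon\operatorname{Im}P_n^2\to\operatorname{Im}P_m^2$. Splitting and adapted norm. $E_n^s=\operatorname{Im}P_n^1$, $E_n^u=\operatorname{Im}P_n^2$, $E_n^c=\operatorname{Im}P_n^3$, $E_n^{s,u}=E_n^s\oplus E_n^u$. $X_B^{s,u}$ (resp. $X_B^c$) is the closed subspace of all $\mathbf{x}\in X_B$ with $x_n\in E_n^{s,u}$ (resp. $x_n\in E_n^c$) for all $n$. Each $\mathbf{x}\in X_B$ is uniquely $\mathbf{x}=\mathbf{x}^c+\mathbf{x}^{s,u}$ with $\mathbf{x}^c\in X_B^c$, $\mathbf{x}^{s,u}\in X_B^{s,u}$; here $x_n^c=P_n^3x_n$ and $x_n^{s,u}=x_n-x_n^c$. Put $\|\mathbf{x}\|_B'=\max\{\|\mathbf{x}^c\|_B,\|\mathbf{x}^{s,u}\|_B\}$, a norm on $X_B$ equivalent to $\|\cdot\|_B$. The operator $\mathbb{A}^{s,u}\colon X_B^{s,u}\to X_B^{s,u}$ is the (well-defined, bounded) linear operator $$(\mathbb{A}^{s,u}\mathbf{y})_n=\sum_{m=-\infty}^n\mathcal{A}(n,m)P_m^1y_m-\sum_{m=n+1}^\infty\mathcal{A}(n,m)P_m^2y_m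 .$$ It is characterized by: for $\mathbf{x},\mathbf{y}\in X_B^{s,u}$, $\mathbb{A}^{s,u}\mathbf{y}=\mathbf{x}$ if and only if $x_n-A_{n-1}x_{n-1}=y_n$ for all $n\in\mathbb{Z}$. Quasi-shadowing. For $\delta>0$, a sequence $(y_n)_{n\in\mathbb{Z}}\subset X$ is a $(\delta,B)$-pseudotrajectory for $x_{n+1}=F_n(x_n)$ if $(y_{n+1}-F_n(y_n))_n\in X_B$ and $\|(y_{n+1}-F_n(y_n))_{n}\|_B\le\delta$. The system has the $B$-quasi-shadowing property if for every $\varepsilon>0$ there is $\delta>0$ such that for every $(\delta,B)$-pseudotrajectory $(y_n)_n$ there is $\mathbf{z}=(z_n)_n\in X_B$ with $\|\mathbf{z}\|_B'\le\varepsilon$ such that $x_{n+1}=F_n(x_n)+z_{n+1}^c$ for every $n\in\mathbb{Z}$, where $x_n=y_n+z_n^{s,u}$. It has the $B$-Lipschitz quasi-shadowing property if moreover there is $L>0$ such that, for every $\varepsilon>0$, $\delta$ can be chosen as $\delta=L\varepsilon$. *)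

theory Defs
  imports "HOL-Analysis.Analysis"
begin

text \<open>The carrier \<open>B\<close> is a set of two-sided real sequences and \<open>N\<close> is its norm. The values of \<open>N\<close>
  outside \<open>B\<close> are irrelevant, so every axiom is relativised to \<open>B\<close>.\<close>

locale banach_sequence_space =
  fixes B :: "(int \<Rightarrow> real) set" and N :: "(int \<Rightarrow> real) \<Rightarrow> real"
  assumes zero_mem: "(\<lambda>n. 0) \<in> B"
    and add_mem: "s \<in> B \<Longrightarrow> t \<in> B \<Longrightarrow> (\<lambda>n. s n + t n) \<in> B"
    and scale_mem: "s \<in> B \<Longrightarrow> (\<lambda>n. a * s n) \<in> B"
    and norm_nonneg: "s \<in> B \<Longrightarrow> 0 \<le> N s"
    and norm_eq_0: "s \<in> B \<Longrightarrow> N s = 0 \<longleftrightarrow> s = (\<lambda>n. 0)"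
    and norm_triangle: "s \<in> B \<Longrightarrow> t \<in> B \<Longrightarrow> N (\<lambda>n. s n + t n) \<le> N s + N t"
    and norm_scale: "s \<in> B \<Longrightarrow> N (\<lambda>n. a * s n) = \<bar>a\<bar> * N s"
    and complete: "(\<And>k. S k \<in> B) \<Longrightarrow>
      (\<And>e. e > 0 \<Longrightarrow> \<exists>K. \<forall>k\<ge>K. \<forall>l\<ge>K. N (\<lambda>n. S k n - S l n) < e) \<Longrightarrow>
      \<exists>s\<in>B. (\<lambda>k::nat. N (\<lambda>n. S k n - s n)) \<longlonglongrightarrow> 0"
    and solid_mem: "s' \<in> B \<Longrightarrow> (\<And>n. \<bar>s n\<bar> \<le> \<bar>s' n\<bar>) \<Longrightarrow> s \<in> B"
    and solid_norm: "s' \<in> B \<Longrightarrow> (\<And>n. \<bar>s n\<bar> \<le> \<bar>s' n\<bar>) \<Longrightarrow> N s \<le> N s'"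

locale admissible_sequence_space = banach_sequence_space +
  assumes indicator_mem: "(indicator {n} :: int \<Rightarrow> real) \<in> B"
    and indicator_norm_pos: "N (indicator {n}) > 0"
    and shift_mem: "s \<in> B \<Longrightarrow> (\<lambda>n. s (n + m)) \<in> B"
    and shift_norm: "s \<in> B \<Longrightarrow> N (\<lambda>n. s (n + m)) = N s"
    and indicator_norm_0: "N (indicator {0}) = 1"

definition XB :: "(int \<Rightarrow> real) set \<Rightarrow> (int \<Rightarrow> 'a::banach) set" where
  "XB B = {x. (\<lambda>n. norm (x n)) \<in> B}"

definition normXB :: "((int \<Rightarrow> real) \<Rightarrow> real) \<Rightarrow> (int \<Rightarrow> 'a::banach) \<Rightarrow> real" where
  "normXB N x = N (\<lambda>n. norm (x n))"

primrec iterate_from :: "(int \<Rightarrow> 'a::banach \<Rightarrow>\<^sub>L 'a) \<Rightarrow> int \<Rightarrow> nat \<Rightarrow> 'a \<Rightarrow>\<^sub>L 'a" where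
  "iterate_from A n 0 = id_blinfun"
| "iterate_from A n (Suc k) = A (n + int k) o\<^sub>L iterate_from A n k"

text \<open>\<open>forward A m n\<close> is \<open>A\<^sub>m\<^sub>-\<^sub>1 \<cdots> A\<^sub>n\<close>; it is only meant for \<open>n \<le> m\<close>.\<close>

definition forward :: "(int \<Rightarrow> 'a::banach \<Rightarrow>\<^sub>L 'a) \<Rightarrow> int \<Rightarrow> int \<Rightarrow> 'a \<Rightarrow>\<^sub>L 'a" where
  "forward A m n = iterate_from A n (nat (m - n))"

text \<open>For \<open>m < n\<close> the value is only meaningful on the range of \<open>P2 n\<close>, where it is the inverse of the
  bijection from the range of \<open>P2 m\<close> onto the range of \<open>P2 n\<close> induced by \<open>forward A n m\<close>.\<close>

definition cocycle ::
  "(int \<Rightarrow> 'a::banach \<Rightarrow>\<^sub>L 'a) \<Rightarrow> (int \<Rightarrow> 'a \<Rightarrow>\<^sub>L 'a) \<Rightarrow> int \<Rightarrow> int \<Rightarrow> 'a \<Rightarrow> 'a" where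
  "cocycle A P2 m n x =
     (if n \<le> m then blinfun_apply (forward A m n) x
      else the_inv_into (range (blinfun_apply (P2 m))) (blinfun_apply (forward A n m)) x)"

text \<open>In the last condition \<open>bounded_linear\<close> only ensures that \<open>onorm\<close>, a real supremum, is
  the genuine operator norm. It follows from the other conditions by the open mapping theorem.\<close>

definition partial_exp_dichotomy ::
  "(int \<Rightarrow> 'a::banach \<Rightarrow>\<^sub>L 'a) \<Rightarrow> (int \<Rightarrow> 'a \<Rightarrow>\<^sub>L 'a) \<Rightarrow> (int \<Rightarrow> 'a \<Rightarrow>\<^sub>L 'a) \<Rightarrow> (int \<Rightarrow> 'a \<Rightarrow>\<^sub>L 'a)
    \<Rightarrow> real \<Rightarrow> real \<Rightarrow> real \<Rightarrow> bool" where
  "partial_exp_dichotomy A P1 P2 P3 D b d \<longleftrightarrow>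
     D > 0 \<and> b > 0 \<and> d > 0 \<and>
     (\<forall>P\<in>{P1, P2, P3}. \<forall>n. P n o\<^sub>L P n = P n \<and> A n o\<^sub>L P n = P (n + 1) o\<^sub>L A n) \<and>
     (\<forall>n. P1 n + P2 n + P3 n = id_blinfun) \<and>
     (\<forall>n. bij_betw (blinfun_apply (A n))
            (range (blinfun_apply (P2 n))) (range (blinfun_apply (P2 (n + 1))))) \<and>
     (\<forall>m n. n \<le> m \<longrightarrow> norm (forward A m n o\<^sub>L P1 n) \<le> D * exp (- d * of_int (m - n))) \<and>
     (\<forall>m n. m \<le> n \<longrightarrow> bounded_linear (\<lambda>x. cocycle A P2 m n (P2 n x)) \<and>
                      onorm (\<lambda>x. cocycle A P2 m n (P2 n x)) \<le> D * exp (- b * of_int (n - m)))"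

definition c_part :: "(int \<Rightarrow> 'a::banach \<Rightarrow>\<^sub>L 'a) \<Rightarrow> (int \<Rightarrow> 'a) \<Rightarrow> int \<Rightarrow> 'a" where
  "c_part P3 x n = P3 n (x n)"

definition su_part :: "(int \<Rightarrow> 'a::banach \<Rightarrow>\<^sub>L 'a) \<Rightarrow> (int \<Rightarrow> 'a) \<Rightarrow> int \<Rightarrow> 'a" where
  "su_part P3 x n = x n - c_part P3 x n"

definition normXB' ::
  "((int \<Rightarrow> real) \<Rightarrow> real) \<Rightarrow> (int \<Rightarrow> 'a::banach \<Rightarrow>\<^sub>L 'a) \<Rightarrow> (int \<Rightarrow> 'a) \<Rightarrow> real" where
  "normXB' N P3 x = max (normXB N (c_part P3 x)) (normXB N (su_part P3 x))"

definition A_su ::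
  "(int \<Rightarrow> 'a::banach \<Rightarrow>\<^sub>L 'a) \<Rightarrow> (int \<Rightarrow> 'a \<Rightarrow>\<^sub>L 'a) \<Rightarrow> (int \<Rightarrow> 'a \<Rightarrow>\<^sub>L 'a)
    \<Rightarrow> (int \<Rightarrow> 'a) \<Rightarrow> int \<Rightarrow> 'a" where
  "A_su A P1 P2 y n =
     (\<Sum>\<^sub>\<infinity>m\<in>{..n}. cocycle A P2 n m (P1 m (y m))) -
     (\<Sum>\<^sub>\<infinity>m\<in>{n+1..}. cocycle A P2 n m (P2 m (y m)))"

definition G_op ::
  "(int \<Rightarrow> 'a::banach \<Rightarrow>\<^sub>L 'a) \<Rightarrow> (int \<Rightarrow> 'a \<Rightarrow>\<^sub>L 'a) \<Rightarrow> (int \<Rightarrow> 'a \<Rightarrow>\<^sub>L 'a) \<Rightarrow> (int \<Rightarrow> 'a \<Rightarrow>\<^sub>L 'a)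
    \<Rightarrow> (int \<Rightarrow> 'a) \<Rightarrow> int \<Rightarrow> 'a" where
  "G_op A P1 P2 P3 x n = - c_part P3 x n + A_su A P1 P2 (su_part P3 x) n"

text \<open>The operator norm on \<open>XB B\<close> with respect to the adapted norm, in the form of \<open>onorm\<close>:
  \<open>x = 0\<close> contributes \<open>0 / 0 = 0\<close>.\<close>

definition onormXB' ::
  "(int \<Rightarrow> real) set \<Rightarrow> ((int \<Rightarrow> real) \<Rightarrow> real) \<Rightarrow> (int \<Rightarrow> 'a::banach \<Rightarrow>\<^sub>L 'a)
    \<Rightarrow> ((int \<Rightarrow> 'a) \<Rightarrow> int \<Rightarrow> 'a) \<Rightarrow> real" where
  "onormXB' B N P3 T = (SUP x\<in>XB B. normXB' N P3 (T x) / normXB' N P3 x)"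

definition pseudotrajectory ::
  "(int \<Rightarrow> real) set \<Rightarrow> ((int \<Rightarrow> real) \<Rightarrow> real) \<Rightarrow> (int \<Rightarrow> 'a::banach \<Rightarrow> 'a)
    \<Rightarrow> real \<Rightarrow> (int \<Rightarrow> 'a) \<Rightarrow> bool" where
  "pseudotrajectory B N F \<delta> y \<longleftrightarrow>
     (\<lambda>n. y (n + 1) - F n (y n)) \<in> XB B \<and> normXB N (\<lambda>n. y (n + 1) - F n (y n)) \<le> \<delta>"

definition quasi_shadowed ::
  "(int \<Rightarrow> real) set \<Rightarrow> ((int \<Rightarrow> real) \<Rightarrow> real) \<Rightarrow> (int \<Rightarrow> 'a::banach \<Rightarrow>\<^sub>L 'a)
    \<Rightarrow> (int \<Rightarrow> 'a \<Rightarrow> 'a) \<Rightarrow> real \<Rightarrow> (int \<Rightarrow> 'a) \<Rightarrow> bool" where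
  "quasi_shadowed B N P3 F \<epsilon> y \<longleftrightarrow>
     (\<exists>z\<in>XB B. normXB' N P3 z \<le> \<epsilon> \<and>
        (let x = (\<lambda>n. y n + su_part P3 z n)
         in \<forall>n. x (n + 1) = F n (x n) + c_part P3 z (n + 1)))"

definition quasi_shadowing ::
  "(int \<Rightarrow> real) set \<Rightarrow> ((int \<Rightarrow> real) \<Rightarrow> real) \<Rightarrow> (int \<Rightarrow> 'a::banach \<Rightarrow>\<^sub>L 'a)
    \<Rightarrow> (int \<Rightarrow> 'a \<Rightarrow> 'a) \<Rightarrow> bool" where
  "quasi_shadowing B N P3 F \<longleftrightarrow>
     (\<forall>\<epsilon>>0. \<exists>\<delta>>0. \<forall>y. pseudotrajectory B N F \<delta> y \<longrightarrow> quasi_shadowed B N P3 F \<epsilon> y)"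

definition lipschitz_quasi_shadowing ::
  "(int \<Rightarrow> real) set \<Rightarrow> ((int \<Rightarrow> real) \<Rightarrow> real) \<Rightarrow> (int \<Rightarrow> 'a::banach \<Rightarrow>\<^sub>L 'a)
    \<Rightarrow> (int \<Rightarrow> 'a \<Rightarrow> 'a) \<Rightarrow> bool" where
  "lipschitz_quasi_shadowing B N P3 F \<longleftrightarrow>
     quasi_shadowing B N P3 F \<and>
     (\<exists>L>0. \<forall>\<epsilon>>0. \<forall>y. pseudotrajectory B N F (L * \<epsilon>) y \<longrightarrow> quasi_shadowed B N P3 F \<epsilon> y)"

end

theory Submission
  imports Defs
begin

text \<open>Writing \<open>x = y + z\<^sup>s\<^sup>u\<close>, the required identity says that \<open>z\<close> is a fixed point of \<open>z \<mapsto> G (S z)\<close>, where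
  \<open>(S z)\<^sub>n = A\<^sub>n\<^sub>-\<^sub>1 y\<^sub>n\<^sub>-\<^sub>1 + f\<^sub>n\<^sub>-\<^sub>1 (y\<^sub>n\<^sub>-\<^sub>1 + z\<^sup>s\<^sup>u\<^sub>n\<^sub>-\<^sub>1) - y\<^sub>n\<close>. Since \<open>\<parallel>P\<^sup>3\<parallel> \<le> 1 + 2D\<close> and the complementary
  projection has norm at most \<open>2D\<close>, this map is Lipschitz in the adapted norm with constant
  \<open>2cD(1 + 2D)\<parallel>G\<parallel> < 1/2\<close>. The fixed point then has adapted norm at most \<open>2\<parallel>G (S 0)\<parallel>\<close>, which is at most
  \<open>2(1 + 2D)\<parallel>G\<parallel>\<delta>\<close>. The boundedness of \<open>\<A>\<^sup>s\<^sup>u\<close> comes from convergence in \<open>B\<close> of the convolution of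
  a sequence with an exponentially decaying kernel.\<close>

subsection \<open>Admissible sequence spaces\<close>

context banach_sequence_space
begin

lemma diff_mem: "s \<in> B \<Longrightarrow> t \<in> B \<Longrightarrow> (\<lambda>n. s n - t n) \<in> B"
  using add_mem[of s "\<lambda>n. (-1) * t n"] scale_mem[of t "-1"] by simp

lemma norm_of_zero: "N (\<lambda>n. 0) = 0"
  using norm_eq_0[OF zero_mem] by simp

lemma sum_mem: "(\<And>i. i \<in> I \<Longrightarrow> u i \<in> B) \<Longrightarrow> (\<lambda>n. \<Sum>i\<in>I. u i n) \<in> B"
  by (induction I rule: infinite_finite_induct) (auto intro: zero_mem add_mem)

lemma norm_sum_le: "(\<And>i. i \<in> I \<Longrightarrow> u i \<in> B) \<Longrightarrow> N (\<lambda>n. \<Sum>i\<in>I. u i n) \<le> (\<Sum>i\<in>I. N (u i))"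
proof (induction I rule: infinite_finite_induct)
  case (insert i I)
  then have "N (\<lambda>n. u i n + (\<Sum>i\<in>I. u i n)) \<le> N (u i) + N (\<lambda>n. \<Sum>i\<in>I. u i n)"
    by (intro norm_triangle sum_mem) auto
  also have "\<dots> \<le> N (u i) + (\<Sum>i\<in>I. N (u i))"
    using insert.IH insert.prems by simp
  finally show ?case
    using insert.hyps by simp
qed (simp_all add: norm_of_zero)

lemma XB_add: "x \<in> XB B \<Longrightarrow> y \<in> XB B \<Longrightarrow> (\<lambda>n. x n + y n) \<in> XB B"
  unfolding XB_def mem_Collect_eq
  by (rule solid_mem[OF add_mem[of "\<lambda>n. norm (x n)" "\<lambda>n. norm (y n)"]])
    (auto intro: norm_triangle_ineq)

text \<open>Solidity compares absolute values, so the scalar sequence \<open>C * norm (y n)\<close>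
  enters through its modulus. This gives \<open>\<bar>C\<bar>\<close> without a sign condition on
  \<open>C\<close>.\<close>

lemma XB_dominated:
  assumes "y \<in> XB B" "\<And>n. norm (x n) \<le> C * norm (y n)"
  shows "x \<in> XB B" "normXB N x \<le> \<bar>C\<bar> * normXB N y"
proof -
  have *: "(\<lambda>n. C * norm (y n)) \<in> B"
    using assms(1) by (auto simp: XB_def intro: scale_mem)
  have le: "\<bar>norm (x n)\<bar> \<le> \<bar>C * norm (y n)\<bar>" for n
    using assms(2)[of n] by simp
  show "x \<in> XB B"
    unfolding XB_def using solid_mem[OF *, of "\<lambda>n. norm (x n)"] le by simp
  have "N (\<lambda>n. norm (x n)) \<le> N (\<lambda>n. C * norm (y n))"
    using solid_norm[OF *, of "\<lambda>n. norm (x n)"] le by simp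
  then show "normXB N x \<le> \<bar>C\<bar> * normXB N y"
    using assms(1) by (simp add: normXB_def XB_def norm_scale)
qed

lemma XB_uminus: "x \<in> XB B \<Longrightarrow> (\<lambda>n. - x n) \<in> XB B"
  by (rule XB_dominated(1)[where C = 1 and y = x]) auto

lemma XB_diff: "x \<in> XB B \<Longrightarrow> y \<in> XB B \<Longrightarrow> (\<lambda>n. x n - y n) \<in> XB B"
  using XB_add[OF _ XB_uminus] by force

lemma XB_zero: "(\<lambda>n. 0) \<in> XB B"
  by (simp add: XB_def zero_mem)

lemma normXB_nonneg: "x \<in> XB B \<Longrightarrow> 0 \<le> normXB N x"
  by (simp add: XB_def normXB_def norm_nonneg)

lemma normXB_triangle:
  assumes "x \<in> XB B" "y \<in> XB B"
  shows "normXB N (\<lambda>n. x n + y n) \<le> normXB N x + normXB N y"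
proof -
  have "N (\<lambda>n. norm (x n + y n)) \<le> N (\<lambda>n. norm (x n) + norm (y n))"
    using assms by (intro solid_norm add_mem) (auto simp: XB_def intro: norm_triangle_ineq)
  also have "\<dots> \<le> normXB N x + normXB N y"
    using assms unfolding normXB_def XB_def by (auto intro: norm_triangle)
  finally show ?thesis by (simp add: normXB_def)
qed

lemma normXB_uminus: "normXB N (\<lambda>n. - x n) = normXB N x"
  by (simp add: normXB_def)

lemma normXB_zero: "normXB N (\<lambda>n. 0) = 0"
  by (simp add: normXB_def norm_of_zero)

lemma normXB_eq_0: "x \<in> XB B \<Longrightarrow> normXB N x = 0 \<longleftrightarrow> x = (\<lambda>n. 0)"
  by (auto simp: XB_def normXB_def norm_eq_0 fun_eq_iff)

end

section \<open>Shift invariance: pointwise limits, series and convolutions\<close>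

context admissible_sequence_space
begin

lemma norm_indicator: "N (indicator {n}) = 1"
proof -
  have "(\<lambda>k. indicator {0} (k + - n)) = (indicator {n} :: int \<Rightarrow> real)"
    by (auto simp: fun_eq_iff indicator_def)
  with shift_norm[OF indicator_mem[of 0], of "- n"] indicator_norm_0 show ?thesis
    by simp
qed

text \<open>The single spike \<open>s n * indicator {n}\<close> is dominated by \<open>s\<close>,
  and every indicator has norm 1. Point evaluations are therefore continuous on
  \<open>B\<close>.\<close>

lemma abs_le_norm:
  assumes "s \<in> B"
  shows "\<bar>s n\<bar> \<le> N s"
proof -
  have "N (\<lambda>k. s n * indicator {n} k) \<le> N s"
    by (rule solid_norm[OF assms]) (simp add: indicator_def)
  then show ?thesis
    using norm_scale[OF indicator_mem] by (simp add: norm_indicator)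
qed

lemma norm_le_normXB: "x \<in> XB B \<Longrightarrow> norm (x n) \<le> normXB N x"
  using abs_le_norm[of "\<lambda>n. norm (x n)" n] by (simp add: XB_def normXB_def)

text \<open>Completeness provides some norm limit \<open>t\<close>; continuity of point evaluations
  forces it to be the pointwise limit. Later limits can thus be written down pointwise.\<close>

lemma complete_pointwise:
  assumes S: "\<And>k. S k \<in> B"
    and C: "\<And>e. e > 0 \<Longrightarrow> \<exists>K. \<forall>k\<ge>K. \<forall>l\<ge>K. N (\<lambda>n. S k n - S l n) < e"
    and lim: "\<And>n. (\<lambda>k::nat. S k n) \<longlonglongrightarrow> s n"
  shows "s \<in> B" "(\<lambda>k. N (\<lambda>n. S k n - s n)) \<longlonglongrightarrow> 0"
proof -
  obtain t where t: "t \<in> B" "(\<lambda>k. N (\<lambda>n. S k n - t n)) \<longlonglongrightarrow> 0"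
    using complete[OF S C] by blast
  have "s n = t n" for n
  proof (rule LIMSEQ_unique[OF lim])
    have "(\<lambda>k. S k n - t n) \<longlonglongrightarrow> 0"
      by (rule Lim_null_comparison[OF _ t(2)])
        (use abs_le_norm[OF diff_mem[OF S t(1)]] in simp)
    then show "(\<lambda>k. S k n) \<longlonglongrightarrow> t n"
      by (simp add: LIM_zero_iff)
  qed
  then have "s = t" by auto
  with t show "s \<in> B" "(\<lambda>k. N (\<lambda>n. S k n - s n)) \<longlonglongrightarrow> 0" by auto
qed

text \<open>This is the usual fact that absolutely convergent series converge in a Banach space,
  with the sum identified pointwise: the partial sums are Cauchy because their differences are
  bounded by blocks of the scalar series.\<close>

lemma suminf_mem:
  assumes u: "\<And>k. u k \<in> B" and sm: "summable (\<lambda>k. N (u k))"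
  shows "summable (\<lambda>k. u k n)" "(\<lambda>n. \<Sum>k. u k n) \<in> B"
    "N (\<lambda>n. \<Sum>k. u k n) \<le> (\<Sum>k. N (u k))"
proof -
  show pw: "summable (\<lambda>k. u k n)" for n
    by (rule summable_comparison_test'[OF sm, of 0]) (use abs_le_norm[OF u] in simp)
  define S where "S k n = (\<Sum>i<k. u i n)" for k n
  have SB: "S k \<in> B" for k
    unfolding S_def using u by (intro sum_mem)
  have step: "N (\<lambda>n. S k n - S l n) \<le> (\<Sum>i\<in>{l..<k}. N (u i))" if "l \<le> k" for k l
  proof -
    have "(\<lambda>n. S k n - S l n) = (\<lambda>n. \<Sum>i\<in>{l..<k}. u i n)"
      using that by (auto simp: S_def sum_diff_nat_ivl lessThan_atLeast0)
    then show ?thesis using norm_sum_le[of "{l..<k}" u] u by simp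
  qed
  have sym: "N (\<lambda>n. S k n - S l n) = N (\<lambda>n. S l n - S k n)" for k l
    using norm_scale[OF diff_mem[OF SB SB], of "-1" k l] by simp
  have cauchy: "\<exists>K. \<forall>k\<ge>K. \<forall>l\<ge>K. N (\<lambda>n. S k n - S l n) < e" if "e > 0" for e
  proof -
    have "\<exists>K. \<forall>m\<ge>K. \<forall>n. \<bar>\<Sum>i\<in>{m..<n}. N (u i)\<bar> < e"
      using sm[unfolded summable_Cauchy] that unfolding real_norm_def by blast
    then obtain K where K: "\<And>m n. m \<ge> K \<Longrightarrow> \<bar>\<Sum>i\<in>{m..<n}. N (u i)\<bar> < e"
      by blast
    have lt: "N (\<lambda>n. S k n - S l n) < e" if "l \<ge> K" "l \<le> k" for k l
      using step[OF that(2)] K[OF that(1), of k] by linarith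
    have "N (\<lambda>n. S k n - S l n) < e" if "k \<ge> K" "l \<ge> K" for k l
    proof (cases "l \<le> k")
      case False
      then show ?thesis using lt[of k l] that sym[of k l] by simp
    qed (use lt that in blast)
    then show ?thesis by blast
  qed
  have lim: "(\<lambda>k. S k n) \<longlonglongrightarrow> (\<Sum>k. u k n)" for n
    unfolding S_def by (rule summable_LIMSEQ[OF pw])
  let ?s = "\<lambda>n. \<Sum>k. u k n"
  note cp = complete_pointwise[of S ?s, OF SB cauchy lim]
  show s: "?s \<in> B" by (rule cp(1))
  \<comment> \<open>Split the limit into a partial sum and a remainder; the remainder vanishes as
    \<open>k\<close> grows.\<close>
  have "N ?s \<le> (\<Sum>k. N (u k)) + N (\<lambda>n. S k n - ?s n)" for k
  proof -
    have "N ?s = N (\<lambda>n. S k n + (-1) * (S k n - ?s n))" by simp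
    also have "\<dots> \<le> N (S k) + N (\<lambda>n. (-1) * (S k n - ?s n))"
      using diff_mem[OF SB s] by (intro norm_triangle SB scale_mem)
    also have "N (\<lambda>n. (-1) * (S k n - ?s n)) = N (\<lambda>n. S k n - ?s n)"
      using norm_scale[OF diff_mem[OF SB s], of "-1" k] by simp
    also have "N (S k) \<le> (\<Sum>i<k. N (u i))"
      unfolding S_def by (rule norm_sum_le[OF u])
    also have "\<dots> \<le> (\<Sum>k. N (u k))"
      by (rule sum_le_suminf[OF sm]) (auto intro: norm_nonneg u)
    finally show ?thesis by simp
  qed
  moreover have "(\<lambda>k. (\<Sum>k. N (u k)) + N (\<lambda>n. S k n - ?s n)) \<longlonglongrightarrow> (\<Sum>k. N (u k)) + 0"
    by (intro tendsto_intros cp(2))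
  ultimately show "N ?s \<le> (\<Sum>k. N (u k))"
    by (intro LIMSEQ_le_const) auto
qed

text \<open>For fixed \<open>k\<close> the terms, as a sequence in \<open>n\<close>, are dominated
  by \<open>a k\<close> times a shift of \<open>norm (y n)\<close>. Shift invariance bounds their
  norm by \<open>a k * normXB N y\<close>, so \<open>suminf_mem\<close> applies. The injection
  \<open>\<sigma>\<close> lets one statement serve both sums over the past and sums over the
  future.\<close>

lemma dominated_convolution:
  fixes y v and \<sigma> :: "nat \<Rightarrow> int" and a :: "nat \<Rightarrow> real"
  assumes y: "y \<in> XB B" and \<sigma>: "inj \<sigma>" and a: "summable a" "\<And>k. 0 \<le> a k"
    and v: "\<And>n k. norm (v n (n + \<sigma> k)) \<le> a k * norm (y (n + \<sigma> k))"
  shows "v n summable_on range (\<lambda>k. n + \<sigma> k)"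
    "(\<lambda>n. infsum (v n) (range (\<lambda>k. n + \<sigma> k))) \<in> XB B"
    "normXB N (\<lambda>n. infsum (v n) (range (\<lambda>k. n + \<sigma> k))) \<le> suminf a * normXB N y"
proof -
  define u where "u k n = a k * norm (y (n + \<sigma> k))" for k n
  have yB: "(\<lambda>n. norm (y n)) \<in> B" using y by (simp add: XB_def)
  have uB: "u k \<in> B" for k
    unfolding u_def by (intro scale_mem shift_mem[OF yB])
  have Nu: "N (u k) = a k * normXB N y" for k
    unfolding u_def using norm_scale[OF shift_mem[OF yB, of "\<sigma> k"], of "a k"] a(2)[of k]
    by (simp add: shift_norm[OF yB] normXB_def)
  have sm: "summable (\<lambda>k. N (u k))"
    unfolding Nu using a(1) by (rule summable_mult2)
  note um = suminf_mem[OF uB sm]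
  have i: "inj (\<lambda>k. n + \<sigma> k)" for n
    using \<sigma> by (auto simp: inj_on_def)
  have smn: "summable (\<lambda>k. norm (v n (n + \<sigma> k)))" for n
    by (rule summable_comparison_test'[OF um(1)[of n], of 0]) (use v in \<open>simp add: u_def\<close>)
  have hs: "(v n has_sum (\<Sum>k. v n (n + \<sigma> k))) (range (\<lambda>k. n + \<sigma> k))" for n
    unfolding has_sum_reindex[OF i] o_def
    by (rule norm_summable_imp_has_sum[OF smn summable_sums[OF summable_norm_cancel[OF smn]]])
  then show "v n summable_on range (\<lambda>k. n + \<sigma> k)"
    by (auto simp: summable_on_def)
  have "norm (infsum (v n) (range (\<lambda>k. n + \<sigma> k))) \<le> (\<Sum>k. u k n)" for n
    unfolding infsumI[OF hs] using v by (intro norm_suminf_le um(1)) (simp add: u_def)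
  then have le: "\<bar>norm (infsum (v n) (range (\<lambda>k. n + \<sigma> k)))\<bar> \<le> \<bar>\<Sum>k. u k n\<bar>" for n
    unfolding abs_norm_cancel by (rule order_trans) (rule abs_ge_self)
  show "(\<lambda>n. infsum (v n) (range (\<lambda>k. n + \<sigma> k))) \<in> XB B"
    unfolding XB_def mem_Collect_eq using um(2) le by (rule solid_mem)
  have "normXB N (\<lambda>n. infsum (v n) (range (\<lambda>k. n + \<sigma> k))) \<le> N (\<lambda>n. \<Sum>k. u k n)"
    unfolding normXB_def using um(2) le by (rule solid_norm)
  also have "\<dots> \<le> (\<Sum>k. N (u k))" by (rule um(3))
  also have "\<dots> = suminf a * normXB N y"
    unfolding Nu by (rule suminf_mult2[OF a(1), symmetric])
  finally show "normXB N (\<lambda>n. infsum (v n) (range (\<lambda>k. n + \<sigma> k))) \<le> suminf a * normXB N y" .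
qed

text \<open>Completeness of \<open>B\<close> speaks about real sequences only. The candidate limit
  is found pointwise in the Banach space, and completeness of \<open>B\<close> is then applied to
  sequences of norms.\<close>

lemma XB_complete:
  fixes x :: "nat \<Rightarrow> int \<Rightarrow> 'b::banach"
  assumes x: "\<And>k. x k \<in> XB B"
    and C: "\<And>e. e > 0 \<Longrightarrow> \<exists>K. \<forall>k\<ge>K. \<forall>l\<ge>K. normXB N (\<lambda>n. x k n - x l n) < e"
  shows "\<exists>z\<in>XB B. (\<lambda>k. normXB N (\<lambda>n. x k n - z n)) \<longlonglongrightarrow> 0"
proof -
  have "Cauchy (\<lambda>k. x k n)" for n
    unfolding Cauchy_def dist_norm
    using C by (blast intro: order_le_less_trans[OF norm_le_normXB[OF XB_diff[OF x x]]])
  then obtain z where z: "\<And>n. (\<lambda>k. x k n) \<longlonglongrightarrow> z n"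
    unfolding Cauchy_convergent_iff convergent_def by metis
  \<comment> \<open>The base sequence \<open>a\<close> is arbitrary because it is used twice:
    \<open>a = 0\<close> shows that \<open>z\<close> lies in the space, and \<open>a = z\<close>
    shows convergence to \<open>z\<close>.\<close>
  have cauchy: "\<exists>K. \<forall>k\<ge>K. \<forall>l\<ge>K. N (\<lambda>n. norm (x k n - a n) - norm (x l n - a n)) < e"
    if "e > 0" for e a
  proof -
    have "N (\<lambda>n. norm (x k n - a n) - norm (x l n - a n)) \<le> normXB N (\<lambda>n. x k n - x l n)" for k l
      unfolding normXB_def
    proof (rule solid_norm)
      show "(\<lambda>n. norm (x k n - x l n)) \<in> B" using XB_diff[OF x x] by (simp add: XB_def)
      show "\<bar>norm (x k n - a n) - norm (x l n - a n)\<bar> \<le> \<bar>norm (x k n - x l n)\<bar>" for n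
        using norm_triangle_ineq3[of "x k n - a n" "x l n - a n"] by simp
    qed
    then show ?thesis
      using C[OF that] by (blast intro: order_le_less_trans)
  qed
  have "(\<lambda>n. norm (z n - 0)) \<in> B"
  proof (rule complete_pointwise(1)[OF _ cauchy])
    show "(\<lambda>n. norm (x k n - 0)) \<in> B" for k using x by (simp add: XB_def)
  qed (auto intro: tendsto_intros z)
  then have zX: "z \<in> XB B" by (simp add: XB_def)
  have "(\<lambda>k. N (\<lambda>n. norm (x k n - z n) - norm (z n - z n))) \<longlonglongrightarrow> 0"
  proof (rule complete_pointwise(2)[OF _ cauchy])
    show "(\<lambda>n. norm (x k n - z n)) \<in> B" for k using XB_diff[OF x zX] by (simp add: XB_def)
    show "(\<lambda>k. norm (x k n - z n)) \<longlonglongrightarrow> norm (z n - z n)" for n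
      by (intro tendsto_intros z)
  qed
  with zX show ?thesis by (auto simp: normXB_def)
qed

end

subsection \<open>The operator \<open>\<A>\<^sup>s\<^sup>u\<close>\<close>

lemma infsum_diff:
  fixes f g :: "'b \<Rightarrow> 'c::{topological_ab_group_add, t2_space}"
  assumes "f summable_on I" "g summable_on I"
  shows "infsum (\<lambda>i. f i - g i) I = infsum f I - infsum g I"
  using infsum_add[OF assms(1), of "\<lambda>i. - g i"] assms(2)
  by (simp add: infsum_uminus summable_on_uminus)

lemma forward_self: "forward A n n = id_blinfun"
  by (simp add: forward_def)

lemma forward_Suc: "n \<le> m \<Longrightarrow> forward A (m + 1) n = A m o\<^sub>L forward A m n"
proof -
  assume "n \<le> m"
  then have "nat (m + 1 - n) = Suc (nat (m - n))" by simp
  with \<open>n \<le> m\<close> show ?thesis by (simp add: forward_def)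
qed

text \<open>The recursion adds the factor applied last. The unstable part inverts such products and
  needs the factor applied first to be split off.\<close>

lemma iterate_from_Suc_right:
  "iterate_from A n (Suc k) = iterate_from A (n + 1) k o\<^sub>L A n"
proof (induction k)
  case (Suc k)
  have "iterate_from A n (Suc (Suc k)) = A (n + int (Suc k)) o\<^sub>L iterate_from A n (Suc k)"
    by (rule iterate_from.simps)
  also note Suc
  finally show ?case by (auto intro!: blinfun_eqI simp: ac_simps)
qed (auto intro: blinfun_eqI)

lemma forward_Suc_right:
  assumes "n < m"
  shows "forward A m n = forward A m (n + 1) o\<^sub>L A n"
proof -
  have "nat (m - n) = Suc (nat (m - (n + 1)))" using assms by simp
  then show ?thesis unfolding forward_def using iterate_from_Suc_right by metis
qed

text \<open>Apply the decomposition of the identity to \<open>q x\<close>: since \<open>q x + r x = 0\<close>, it gives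
  \<open>p (q x) = - q x\<close>, while \<open>p\<close> is idempotent.\<close>

lemma complementary_projection_zero:
  fixes p q r :: "'b::real_vector \<Rightarrow> 'b"
  assumes lin: "linear p" "linear r"
    and idem: "\<And>v. p (p v) = p v" "\<And>v. q (q v) = q v" "\<And>v. r (r v) = r v"
    and sum: "\<And>v. p v + q v + r v = v"
    and x: "p x = x"
  shows "q x = 0"
proof -
  have "r x = - q x"
    using sum[of x] x by (simp add: add.assoc add_eq_0_iff2)
  then have "r (q x) = q x"
    using idem(3)[of x] linear_neg[OF lin(2)] by simp
  then have "p (q x) + q x = 0"
    using sum[of "q x"] by (simp add: idem(2))
  then have "p (q x) = - q x"
    by (simp add: eq_neg_iff_add_eq_0)
  then have "p (- q x) = - q x"
    using idem(1)[of "q x"] by simp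
  with \<open>p (q x) = - q x\<close> have "q x = - q x"
    using linear_neg[OF lin(1), of "q x"] by simp
  then have "q x + q x = 0"
    by (simp add: eq_neg_iff_add_eq_0)
  then have "(2::real) *\<^sub>R q x = 0"
    by (simp add: scaleR_2)
  then show ?thesis by simp
qed

section \<open>Projections and cocycle under a partial exponential dichotomy\<close>

locale dichotomous_system = admissible_sequence_space B N
  for B :: "(int \<Rightarrow> real) set" and N +
  fixes A P1 P2 P3 :: "int \<Rightarrow> 'a::banach \<Rightarrow>\<^sub>L 'a" and D b d :: real
  assumes dichotomy: "partial_exp_dichotomy A P1 P2 P3 D b d"
begin

lemma constants_pos: "D > 0" "b > 0" "d > 0"
  using dichotomy by (auto simp: partial_exp_dichotomy_def)

lemma projection_idem:
  "P1 n (P1 n x) = P1 n x" "P2 n (P2 n x) = P2 n x" "P3 n (P3 n x) = P3 n x"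
  using dichotomy unfolding partial_exp_dichotomy_def
  by (simp_all flip: blinfun_apply_blinfun_compose)

lemma projection_commute:
  "A n (P1 n x) = P1 (n + 1) (A n x)" "A n (P3 n x) = P3 (n + 1) (A n x)"
  using dichotomy unfolding partial_exp_dichotomy_def
  by (simp_all flip: blinfun_apply_blinfun_compose)

lemma projection_sum: "P1 n x + P2 n x + P3 n x = x"
proof -
  have "blinfun_apply (P1 n + P2 n + P3 n) x = x"
    using dichotomy by (simp add: partial_exp_dichotomy_def)
  then show ?thesis by (simp add: blinfun.add_left)
qed

lemma linear_blinfun: "linear (blinfun_apply T)"
  by (simp add: blinfun.bounded_linear_right bounded_linear.linear)

text \<open>Mutual annihilation is not among the conditions of the dichotomy; it follows from
  idempotence and the decomposition of the identity, applied to the fixed vector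
  \<open>P1 n x\<close> of \<open>P1 n\<close>.\<close>

lemma P3_P1: "P3 n (P1 n x) = 0"
proof (rule complementary_projection_zero[where p = "P1 n" and q = "P3 n" and r = "P2 n"])
  show "P1 n v + P3 n v + P2 n v = v" for v
    using projection_sum[of n v] by (simp add: algebra_simps)
qed (simp_all add: linear_blinfun projection_idem)

lemma P3_P2: "P3 n (P2 n x) = 0"
proof (rule complementary_projection_zero[where p = "P2 n" and q = "P3 n" and r = "P1 n"])
  show "P2 n v + P3 n v + P1 n v = v" for v
    using projection_sum[of n v] by (simp add: algebra_simps)
qed (simp_all add: linear_blinfun projection_idem)

lemma P3_forward: "n \<le> m \<Longrightarrow> P3 m (forward A m n x) = forward A m n (P3 n x)"
  by (induction m rule: int_ge_induct)
    (simp_all add: forward_self forward_Suc flip: projection_commute)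

lemma forward_bij_betw:
  "n \<le> m \<Longrightarrow> bij_betw (forward A m n) (range (P2 n)) (range (P2 m))"
proof (induction m rule: int_ge_induct)
  case base
  then show ?case by (simp add: forward_self bij_betw_def inj_on_def)
next
  case (step m)
  have "bij_betw (A m) (range (P2 m)) (range (P2 (m + 1)))"
    using dichotomy by (simp add: partial_exp_dichotomy_def)
  with step show ?case
    using bij_betw_trans[of "forward A m n"] by (simp add: forward_Suc o_def)
qed

lemma cocycle_stable: "m \<le> n \<Longrightarrow> cocycle A P2 n m x = forward A n m x"
  by (simp add: cocycle_def)

lemma P3_cocycle_stable: "m \<le> n \<Longrightarrow> P3 n (cocycle A P2 n m (P1 m x)) = 0"
  by (simp add: cocycle_stable P3_forward P3_P1 blinfun.zero_right)

lemma A_cocycle_stable: "m \<le> n \<Longrightarrow> A n (cocycle A P2 n m x) = cocycle A P2 (n + 1) m x"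
  by (simp add: cocycle_stable forward_Suc)

lemma cocycle_unstable_mem:
  assumes "n < m"
  shows "cocycle A P2 n m (P2 m x) \<in> range (P2 n)"
    and "forward A m n (cocycle A P2 n m (P2 m x)) = P2 m x"
proof -
  have bij: "bij_betw (forward A m n) (range (P2 n)) (range (P2 m))"
    using assms by (intro forward_bij_betw) simp
  then show "cocycle A P2 n m (P2 m x) \<in> range (P2 n)"
    using assms by (auto simp: cocycle_def bij_betw_def intro!: the_inv_into_into)
  show "forward A m n (cocycle A P2 n m (P2 m x)) = P2 m x"
    using assms bij by (simp add: cocycle_def f_the_inv_into_f_bij_betw)
qed

lemma P3_cocycle_unstable: "n < m \<Longrightarrow> P3 n (cocycle A P2 n m (P2 m x)) = 0"
  using cocycle_unstable_mem(1)[of n m x] P3_P2 by auto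

text \<open>Both sides lie in the range of \<open>P2 (n + 1)\<close> and are mapped to
  \<open>P2 m x\<close> by \<open>forward A m (n + 1)\<close>, which is injective there.\<close>

lemma A_cocycle_unstable:
  assumes "n < m"
  shows "A n (cocycle A P2 n m (P2 m x)) = cocycle A P2 (n + 1) m (P2 m x)"
proof -
  let ?w = "cocycle A P2 n m (P2 m x)"
  have w: "forward A m (n + 1) (A n ?w) = P2 m x"
    using cocycle_unstable_mem(2)[OF assms, of x] forward_Suc_right[OF assms, of A] by simp
  show ?thesis
  \<comment> \<open>For \<open>m = n + 1\<close> the right-hand cocycle is on the diagonal and takes
    the forward branch of its definition, so no inverse is involved.\<close>
  proof (cases "m = n + 1")
    case True
    with w show ?thesis by (simp add: cocycle_def forward_self)
  next
    case False
    have "bij_betw (A n) (range (P2 n)) (range (P2 (n + 1)))"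
      using dichotomy by (simp add: partial_exp_dichotomy_def)
    then have "A n ?w \<in> range (P2 (n + 1))"
      using cocycle_unstable_mem(1)[OF assms, of x] by (auto simp: bij_betw_def)
    moreover have "inj_on (forward A m (n + 1)) (range (P2 (n + 1)))"
      using forward_bij_betw[of "n + 1" m] assms by (simp add: bij_betw_def)
    ultimately show ?thesis
      using w assms False by (simp add: cocycle_def the_inv_into_f_eq)
  qed
qed

lemma norm_cocycle_stable:
  assumes "m \<le> n"
  shows "norm (cocycle A P2 n m (P1 m x)) \<le> D * exp (- d * (n - m)) * norm x"
proof -
  have "norm (forward A n m o\<^sub>L P1 m) \<le> D * exp (- d * (n - m))"
    using dichotomy assms by (simp add: partial_exp_dichotomy_def)
  then have "norm ((forward A n m o\<^sub>L P1 m) x) \<le> D * exp (- d * (n - m)) * norm x"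
    by (rule order_trans[OF norm_blinfun mult_right_mono]) simp
  with assms show ?thesis by (simp add: cocycle_stable)
qed

lemma bounded_linear_cocycle_unstable:
  "n \<le> m \<Longrightarrow> bounded_linear (\<lambda>x. cocycle A P2 n m (P2 m x))"
  using dichotomy by (simp add: partial_exp_dichotomy_def)

lemma norm_cocycle_unstable:
  assumes "n \<le> m"
  shows "norm (cocycle A P2 n m (P2 m x)) \<le> D * exp (- b * (m - n)) * norm x"
proof -
  have "onorm (\<lambda>x. cocycle A P2 n m (P2 m x)) \<le> D * exp (- b * (m - n))"
    using dichotomy assms by (simp add: partial_exp_dichotomy_def)
  then show ?thesis
    by (rule order_trans[OF onorm[OF bounded_linear_cocycle_unstable[OF assms]] mult_right_mono])
      simp
qed

lemma norm_P1: "norm (P1 n x) \<le> D * norm x"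
  using norm_cocycle_stable[of n n x] by (simp add: cocycle_stable forward_self)

lemma norm_P2: "norm (P2 n x) \<le> D * norm x"
  using norm_cocycle_unstable[of n n x] by (simp add: cocycle_def forward_self)

text \<open>The complement of \<open>P3 n\<close> is \<open>P1 n + P2 n\<close>, and the dichotomy
  estimates on the diagonal bound each summand by \<open>D\<close>.\<close>

lemma norm_diff_P3: "norm (x - P3 n x) \<le> 2 * D * norm x"
proof -
  have "x - P3 n x = P1 n x + P2 n x"
    using projection_sum[of n x] by (simp add: algebra_simps)
  then have "norm (x - P3 n x) \<le> norm (P1 n x) + norm (P2 n x)"
    by (simp add: norm_triangle_ineq)
  with norm_P1[of n x] norm_P2[of n x] show ?thesis by simp
qed

lemma norm_P3: "norm (P3 n x) \<le> (1 + 2 * D) * norm x"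
proof -
  have "norm (P3 n x) \<le> norm x + norm (x - P3 n x)"
    by (metis norm_minus_commute norm_triangle_sub)
  with norm_diff_P3[of x n] show ?thesis by (simp add: algebra_simps)
qed

section \<open>The stable and unstable series as convolutions with exponential kernels\<close>

lemma summable_exp: "a > 0 \<Longrightarrow> summable (\<lambda>k. D * exp (- a * real k))"
proof -
  assume "a > 0"
  then have "summable (\<lambda>k. exp (- a) ^ k)" by (intro summable_geometric) simp
  then have "summable (\<lambda>k. D * exp (- a) ^ k)" by (rule summable_mult)
  then show ?thesis by (simp flip: exp_of_nat_mult add: mult.commute)
qed

lemma atMost_eq_range: "{..n} = range (\<lambda>k. n + - int k)"
proof -
  have "m \<in> range (\<lambda>k. n + - int k)" if "m \<le> n" for m
    using that by (intro image_eqI[of _ _ "nat (n - m)"]) auto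
  then show ?thesis by auto
qed

lemma atLeast_eq_range: "{n + 1..} = range (\<lambda>k. n + (1 + int k))"
proof -
  have "m \<in> range (\<lambda>k. n + (1 + int k))" if "m \<ge> n + 1" for m
    using that by (intro image_eqI[of _ _ "nat (m - n - 1)"]) auto
  then show ?thesis by auto
qed

lemma
  assumes "y \<in> XB B"
  shows stable_summable: "(\<lambda>m. cocycle A P2 n m (P1 m (y m))) summable_on {..n}"
    and stable_mem: "(\<lambda>n. \<Sum>\<^sub>\<infinity>m\<in>{..n}. cocycle A P2 n m (P1 m (y m))) \<in> XB B"
    and stable_bound: "normXB N (\<lambda>n. \<Sum>\<^sub>\<infinity>m\<in>{..n}. cocycle A P2 n m (P1 m (y m)))
      \<le> (\<Sum>k. D * exp (- d * real k)) * normXB N y"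
proof -
  have *: "norm (cocycle A P2 n (n + - int k) (P1 (n + - int k) (y (n + - int k))))
      \<le> D * exp (- d * real k) * norm (y (n + - int k))" for n k
    using norm_cocycle_stable[of "n + - int k" n] by simp
  have inj: "inj (\<lambda>k. - int k)" by (simp add: inj_on_def)
  have pos: "0 \<le> D * exp (- d * real k)" for k using constants_pos by simp
  note dominated_convolution[where v = "\<lambda>n m. cocycle A P2 n m (P1 m (y m))",
      OF assms inj summable_exp[OF constants_pos(3)] pos *, folded atMost_eq_range]
  then show "(\<lambda>m. cocycle A P2 n m (P1 m (y m))) summable_on {..n}"
    "(\<lambda>n. \<Sum>\<^sub>\<infinity>m\<in>{..n}. cocycle A P2 n m (P1 m (y m))) \<in> XB B"
    "normXB N (\<lambda>n. \<Sum>\<^sub>\<infinity>m\<in>{..n}. cocycle A P2 n m (P1 m (y m)))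
      \<le> (\<Sum>k. D * exp (- d * real k)) * normXB N y" by auto
qed

lemma
  assumes "y \<in> XB B"
  shows unstable_summable: "(\<lambda>m. cocycle A P2 n m (P2 m (y m))) summable_on {n+1..}"
    and unstable_mem: "(\<lambda>n. \<Sum>\<^sub>\<infinity>m\<in>{n+1..}. cocycle A P2 n m (P2 m (y m))) \<in> XB B"
    and unstable_bound: "normXB N (\<lambda>n. \<Sum>\<^sub>\<infinity>m\<in>{n+1..}. cocycle A P2 n m (P2 m (y m)))
      \<le> (\<Sum>k. D * exp (- b * real k)) * normXB N y"
proof -
  have *: "norm (cocycle A P2 n (n + (1 + int k)) (P2 (n + (1 + int k)) (y (n + (1 + int k)))))
      \<le> D * exp (- b * real k) * norm (y (n + (1 + int k)))" for n k
  proof -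
    have "norm (cocycle A P2 n (n + (1 + int k)) (P2 (n + (1 + int k)) (y (n + (1 + int k)))))
        \<le> D * exp (- b * (1 + real k)) * norm (y (n + (1 + int k)))"
      using norm_cocycle_unstable[of n "n + (1 + int k)"] by simp
    \<comment> \<open>The future sum starts at distance 1. The resulting factor
      \<open>exp (- b)\<close> is dropped so that the kernel has the form of
      \<open>summable_exp\<close>.\<close>
    also have "\<dots> \<le> D * exp (- b * real k) * norm (y (n + (1 + int k)))"
      using constants_pos by (intro mult_right_mono mult_left_mono) auto
    finally show ?thesis .
  qed
  have inj: "inj (\<lambda>k. 1 + int k)" by (simp add: inj_on_def)
  have pos: "0 \<le> D * exp (- b * real k)" for k using constants_pos by simp
  note dominated_convolution[where v = "\<lambda>n m. cocycle A P2 n m (P2 m (y m))",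
      OF assms inj summable_exp[OF constants_pos(2)] pos *, folded atLeast_eq_range]
  then show "(\<lambda>m. cocycle A P2 n m (P2 m (y m))) summable_on {n+1..}"
    "(\<lambda>n. \<Sum>\<^sub>\<infinity>m\<in>{n+1..}. cocycle A P2 n m (P2 m (y m))) \<in> XB B"
    "normXB N (\<lambda>n. \<Sum>\<^sub>\<infinity>m\<in>{n+1..}. cocycle A P2 n m (P2 m (y m)))
      \<le> (\<Sum>k. D * exp (- b * real k)) * normXB N y" by auto
qed

lemma A_su_mem: "y \<in> XB B \<Longrightarrow> A_su A P1 P2 y \<in> XB B"
  using XB_diff[OF stable_mem unstable_mem] by (simp add: A_su_def[abs_def])

lemma A_su_bounded: "\<exists>K\<ge>0. \<forall>y\<in>XB B :: (int \<Rightarrow> 'a) set. normXB N (A_su A P1 P2 y) \<le> K * normXB N y"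
proof (intro exI conjI ballI)
  let ?K = "(\<Sum>k. D * exp (- d * real k)) + (\<Sum>k. D * exp (- b * real k))"
  show "0 \<le> ?K"
    using constants_pos by (intro add_nonneg_nonneg suminf_nonneg summable_exp) auto
  fix y :: "int \<Rightarrow> 'a" assume y: "y \<in> XB B"
  show "normXB N (A_su A P1 P2 y) \<le> ?K * normXB N y"
    using normXB_triangle[OF stable_mem[OF y] XB_uminus[OF unstable_mem[OF y]]]
      stable_bound[OF y] unstable_bound[OF y]
    by (simp add: normXB_uminus A_su_def[abs_def] distrib_right)
qed

lemma A_su_diff:
  assumes x: "x \<in> XB B" and y: "y \<in> XB B"
  shows "A_su A P1 P2 (\<lambda>n. x n - y n) n = A_su A P1 P2 x n - A_su A P1 P2 y n"
proof -
  let ?s = "\<lambda>x m. cocycle A P2 n m (P1 m (x m))"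
  let ?u = "\<lambda>x m. cocycle A P2 n m (P2 m (x m))"
  have "infsum (?s (\<lambda>n. x n - y n)) {..n} = (\<Sum>\<^sub>\<infinity>m\<in>{..n}. ?s x m - ?s y m)"
    by (rule infsum_cong) (simp add: cocycle_stable blinfun.diff_right)
  then have s: "infsum (?s (\<lambda>n. x n - y n)) {..n} = infsum (?s x) {..n} - infsum (?s y) {..n}"
    by (simp add: infsum_diff[OF stable_summable[OF x] stable_summable[OF y]])
  \<comment> \<open>On the unstable side the cocycle is a set-theoretic inverse; its linearity is
    read off from the \<open>bounded_linear\<close> condition of the dichotomy.\<close>
  have "infsum (?u (\<lambda>n. x n - y n)) {n+1..} = (\<Sum>\<^sub>\<infinity>m\<in>{n+1..}. ?u x m - ?u y m)"
    by (rule infsum_cong)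
      (simp add: linear_diff[OF bounded_linear.linear[OF bounded_linear_cocycle_unstable]])
  then have u: "infsum (?u (\<lambda>n. x n - y n)) {n+1..} = infsum (?u x) {n+1..} - infsum (?u y) {n+1..}"
    by (simp add: infsum_diff[OF unstable_summable[OF x] unstable_summable[OF y]])
  show ?thesis unfolding A_su_def s u by simp
qed

text \<open>The continuous map \<open>P3 n\<close> passes under both infinite sums and annihilates
  every term.\<close>

lemma P3_A_su:
  assumes "y \<in> XB B"
  shows "P3 n (A_su A P1 P2 y n) = 0"
proof -
  have 1: "P3 n (\<Sum>\<^sub>\<infinity>m\<in>{..n}. cocycle A P2 n m (P1 m (y m)))
      = (\<Sum>\<^sub>\<infinity>m\<in>{..n}. P3 n (cocycle A P2 n m (P1 m (y m))))"
    by (intro infsumI[symmetric] has_sum_bounded_linear[OF blinfun.bounded_linear_right]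
        has_sum_infsum stable_summable assms)
  have 2: "P3 n (\<Sum>\<^sub>\<infinity>m\<in>{n+1..}. cocycle A P2 n m (P2 m (y m)))
      = (\<Sum>\<^sub>\<infinity>m\<in>{n+1..}. P3 n (cocycle A P2 n m (P2 m (y m))))"
    by (intro infsumI[symmetric] has_sum_bounded_linear[OF blinfun.bounded_linear_right]
        has_sum_infsum unstable_summable assms)
  have "(\<Sum>\<^sub>\<infinity>m\<in>{..n}. P3 n (cocycle A P2 n m (P1 m (y m)))) = 0"
    by (rule infsum_0) (simp add: P3_cocycle_stable)
  moreover have "(\<Sum>\<^sub>\<infinity>m\<in>{n+1..}. P3 n (cocycle A P2 n m (P2 m (y m)))) = 0"
    by (rule infsum_0) (simp add: P3_cocycle_unstable)
  ultimately show ?thesis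
    unfolding A_su_def blinfun.diff_right 1 2 by simp
qed

text \<open>Applying \<open>A n\<close> termwise moves the base point from \<open>n\<close> to
  \<open>n + 1\<close>, so the two sides differ only in the terms with \<open>m = n + 1\<close>.
  These contribute \<open>P1 (n + 1) (y (n + 1))\<close> and \<open>P2 (n + 1) (y (n + 1))\<close>,
  whose sum is \<open>y (n + 1)\<close> because the central component vanishes.\<close>

lemma A_su_recursion:
  assumes y: "y \<in> XB B" and "P3 (n + 1) (y (n + 1)) = 0"
  shows "A_su A P1 P2 y (n + 1) - A n (A_su A P1 P2 y n) = y (n + 1)"
proof -
  let ?s = "\<lambda>n m. cocycle A P2 n m (P1 m (y m))"
  let ?u = "\<lambda>n m. cocycle A P2 n m (P2 m (y m))"
  have "A n (infsum (?s n) {..n}) = (\<Sum>\<^sub>\<infinity>m\<in>{..n}. A n (?s n m))"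
    by (intro infsumI[symmetric] has_sum_bounded_linear[OF blinfun.bounded_linear_right]
        has_sum_infsum stable_summable y)
  also have "\<dots> = infsum (?s (n + 1)) {..n}"
    by (rule infsum_cong) (simp add: A_cocycle_stable)
  finally have 1: "A n (infsum (?s n) {..n}) = infsum (?s (n + 1)) {..n}" .
  have "?s (n + 1) summable_on {..n}"
    by (rule summable_on_subset_banach[OF stable_summable[OF y]]) auto
  moreover have "{..n + 1} = insert (n + 1) {..n}" by auto
  ultimately have 2: "infsum (?s (n + 1)) {..n + 1}
      = P1 (n + 1) (y (n + 1)) + infsum (?s (n + 1)) {..n}"
    by (simp add: infsum_insert cocycle_def forward_self)
  have "A n (infsum (?u n) {n+1..}) = (\<Sum>\<^sub>\<infinity>m\<in>{n+1..}. A n (?u n m))"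
    by (intro infsumI[symmetric] has_sum_bounded_linear[OF blinfun.bounded_linear_right]
        has_sum_infsum unstable_summable y)
  also have "\<dots> = infsum (?u (n + 1)) {n+1..}"
    by (rule infsum_cong) (simp add: A_cocycle_unstable)
  also have "\<dots> = infsum (?u (n + 1)) (insert (n + 1) {n+1+1..})"
    by (rule arg_cong[where f = "infsum (?u (n + 1))"]) auto
  also have "\<dots> = P2 (n + 1) (y (n + 1)) + infsum (?u (n + 1)) {n+1+1..}"
    by (subst infsum_insert[OF unstable_summable[OF y]]) (auto simp: cocycle_def forward_self)
  finally have 3: "A n (infsum (?u n) {n+1..})
      = P2 (n + 1) (y (n + 1)) + infsum (?u (n + 1)) {n+1+1..}" .
  have "P1 (n + 1) (y (n + 1)) + P2 (n + 1) (y (n + 1)) = y (n + 1)"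
    using projection_sum[of "n + 1" "y (n + 1)"] assms(2) by simp
  then show ?thesis
    unfolding A_su_def blinfun.diff_right 1 2 3 by (simp add: algebra_simps)
qed

subsection \<open>The adapted norm and the operator \<open>G\<close>\<close>

abbreviation "c_comp \<equiv> c_part P3"
abbreviation "su_comp \<equiv> su_part P3"
abbreviation "adapted_norm \<equiv> normXB' N P3"
abbreviation "G \<equiv> G_op A P1 P2 P3"
abbreviation "opnorm \<equiv> onormXB' B N P3"

lemma one_plus_2D: "\<bar>1 + 2 * D\<bar> = 1 + 2 * D" "\<bar>2 * D\<bar> = 2 * D"
  using constants_pos by auto

lemma c_comp_mem: "x \<in> XB B \<Longrightarrow> c_comp x \<in> XB B"
  and normXB_c_comp: "x \<in> XB B \<Longrightarrow> normXB N (c_comp x) \<le> (1 + 2 * D) * normXB N x"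
  using XB_dominated[where x = "c_comp x" and C = "1 + 2 * D" and y = x] norm_P3
  by (auto simp: c_part_def one_plus_2D)

lemma su_comp_mem: "x \<in> XB B \<Longrightarrow> su_comp x \<in> XB B"
  and normXB_su_comp: "x \<in> XB B \<Longrightarrow> normXB N (su_comp x) \<le> 2 * D * normXB N x"
  using XB_dominated[where x = "su_comp x" and C = "2 * D" and y = x] norm_diff_P3
  by (auto simp: c_part_def su_part_def one_plus_2D)

lemma c_comp_plus_su_comp: "c_comp x n + su_comp x n = x n"
  by (simp add: su_part_def)

lemma P3_su_comp: "P3 n (su_comp x n) = 0"
  by (simp add: su_part_def c_part_def blinfun.diff_right projection_idem)

lemma su_comp_su_comp: "su_comp (su_comp x) = su_comp x"
  by (auto simp: su_part_def[of _ "su_comp x"] c_part_def P3_su_comp)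

lemma comp_diff:
  "c_comp (\<lambda>n. x n - y n) = (\<lambda>n. c_comp x n - c_comp y n)"
  "su_comp (\<lambda>n. x n - y n) = (\<lambda>n. su_comp x n - su_comp y n)"
  by (auto simp: su_part_def c_part_def blinfun.diff_right)

lemma adapted_norm_nonneg: "x \<in> XB B \<Longrightarrow> 0 \<le> adapted_norm x"
  by (simp add: normXB'_def le_max_iff_disj normXB_nonneg c_comp_mem)

lemma normXB_le_adapted:
  assumes "x \<in> XB B"
  shows "normXB N x \<le> 2 * adapted_norm x"
  using normXB_triangle[OF c_comp_mem su_comp_mem, OF assms assms]
  by (simp add: c_comp_plus_su_comp normXB'_def)

lemma adapted_le_normXB:
  assumes "x \<in> XB B"
  shows "adapted_norm x \<le> (1 + 2 * D) * normXB N x"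
proof -
  have "2 * D * normXB N x \<le> (1 + 2 * D) * normXB N x"
    using normXB_nonneg[OF assms] by (intro mult_right_mono) auto
  with normXB_c_comp[OF assms] normXB_su_comp[OF assms] show ?thesis
    by (simp add: normXB'_def)
qed

text \<open>\<open>D\<close> may be small, so \<open>2 * D\<close> cannot simply be inserted. The
  projection fixes \<open>su_comp x\<close>, and its norm bound applied there gives the factor:
  either \<open>2 * D \<ge> 1\<close> or the component has norm zero.\<close>

lemma normXB_su_comp_le:
  assumes "x \<in> XB B"
  shows "normXB N (su_comp x) \<le> 2 * D * adapted_norm x"
proof -
  have "normXB N (su_comp x) \<le> 2 * D * normXB N (su_comp x)"
    using normXB_su_comp[OF su_comp_mem[OF assms]] by (simp add: su_comp_su_comp)
  also have "\<dots> \<le> 2 * D * adapted_norm x"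
    using constants_pos by (intro mult_left_mono) (auto simp: normXB'_def)
  finally show ?thesis .
qed

lemma adapted_norm_triangle:
  assumes "x \<in> XB B" "y \<in> XB B" "z \<in> XB B"
  shows "adapted_norm (\<lambda>n. x n - z n)
    \<le> adapted_norm (\<lambda>n. x n - y n) + adapted_norm (\<lambda>n. y n - z n)"
proof -
  have *: "normXB N (\<lambda>n. u n - w n) \<le> normXB N (\<lambda>n. u n - v n) + normXB N (\<lambda>n. v n - w n)"
    if "u \<in> XB B" "v \<in> XB B" "w \<in> XB B" for u v w :: "int \<Rightarrow> 'a"
    using normXB_triangle[OF XB_diff XB_diff, of u v v w] that by simp
  show ?thesis
    unfolding normXB'_def comp_diff
    using *[OF c_comp_mem c_comp_mem c_comp_mem, OF assms]
      *[OF su_comp_mem su_comp_mem su_comp_mem, OF assms] by linarith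
qed

lemma G_mem: "x \<in> XB B \<Longrightarrow> G x \<in> XB B"
  using XB_add[OF XB_uminus[OF c_comp_mem] A_su_mem[OF su_comp_mem]]
  by (simp add: G_op_def[abs_def])

lemma G_diff:
  assumes "x \<in> XB B" "y \<in> XB B"
  shows "G (\<lambda>n. x n - y n) = (\<lambda>n. G x n - G y n)"
  using A_su_diff[OF su_comp_mem su_comp_mem, OF assms]
  by (simp add: G_op_def fun_eq_iff comp_diff)

text \<open>Since \<open>A_su\<close> takes values in the kernel of \<open>P3\<close>, the operator
  \<open>G\<close> respects the splitting: it is minus the identity on the central part and
  \<open>A_su\<close> on the rest.\<close>

lemma comp_G:
  assumes "x \<in> XB B"
  shows "c_comp (G x) = (\<lambda>n. - c_comp x n)" "su_comp (G x) = A_su A P1 P2 (su_comp x)"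
proof -
  show "c_comp (G x) = (\<lambda>n. - c_comp x n)"
    using P3_A_su[OF su_comp_mem[OF assms]]
    by (simp add: G_op_def c_part_def fun_eq_iff blinfun.diff_right projection_idem)
  then show "su_comp (G x) = A_su A P1 P2 (su_comp x)"
    by (simp add: su_part_def[of _ "G x"] G_op_def fun_eq_iff)
qed

text \<open>Use the recursion for \<open>su_comp x\<close>, which equals
  \<open>x - c_comp x\<close>; the minus sign in \<open>G\<close> turns \<open>- c_comp x\<close>
  into \<open>c_comp (G x)\<close>. At a fixed point of \<open>z \<mapsto> G (S z)\<close> this is
  the shadowing identity.\<close>

lemma G_equation:
  assumes "x \<in> XB B"
  shows "su_comp (G x) (n + 1) - A n (su_comp (G x) n) = x (n + 1) + c_comp (G x) (n + 1)"
  using A_su_recursion[OF su_comp_mem[OF assms] P3_su_comp, of n]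
  by (simp add: comp_G[OF assms]) (simp add: su_part_def)

text \<open>Boundedness of \<open>G\<close> is needed for the supremum defining its operator norm to be genuine.\<close>

lemma bdd_above_G:
  "bdd_above ((\<lambda>x. adapted_norm (G x) / adapted_norm x) ` XB B)"
proof -
  obtain K where K: "K \<ge> 0"
    "\<And>y::int \<Rightarrow> 'a. y \<in> XB B \<Longrightarrow> normXB N (A_su A P1 P2 y) \<le> K * normXB N y"
    using A_su_bounded by blast
  \<comment> \<open>The 1 accounts for the central part, where \<open>G\<close> is minus the
    identity; \<open>K\<close> bounds \<open>A_su\<close>.\<close>
  have "adapted_norm (G x) / adapted_norm x \<le> max 1 K" if x: "x \<in> XB B" for x
  proof -
    have "normXB N (A_su A P1 P2 (su_comp x)) \<le> K * adapted_norm x"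
      using K(2)[OF su_comp_mem[OF x]]
      by (rule order_trans) (use K(1) in \<open>auto simp: normXB'_def intro: mult_left_mono\<close>)
    moreover have "normXB N (c_comp x) \<le> 1 * adapted_norm x"
      by (simp add: normXB'_def)
    moreover have "K * adapted_norm x \<le> max 1 K * adapted_norm x"
      "1 * adapted_norm x \<le> max 1 K * adapted_norm x"
      using adapted_norm_nonneg[OF x] by (intro mult_right_mono; simp)+
    ultimately have "adapted_norm (G x) \<le> max 1 K * adapted_norm x"
      by (simp add: normXB'_def[of _ _ "G x"] comp_G[OF x] normXB_uminus)
    then show ?thesis
      using adapted_norm_nonneg[OF x]
      by (cases "adapted_norm x = 0") (auto simp: divide_le_eq)
  qed
  then show ?thesis by (intro bdd_aboveI2)
qed

lemma adapted_norm_zero: "adapted_norm (\<lambda>n. 0) = 0"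
  by (simp add: normXB'_def su_part_def[abs_def] c_part_def[abs_def] blinfun.zero_right normXB_zero)

lemma adapted_norm_eq_0:
  assumes "x \<in> XB B"
  shows "adapted_norm x = 0 \<longleftrightarrow> x = (\<lambda>n. 0)"
proof
  assume "adapted_norm x = 0"
  with normXB_le_adapted[OF assms] normXB_nonneg[OF assms] have "normXB N x = 0" by simp
  then show "x = (\<lambda>n. 0)" using normXB_eq_0[OF assms] by simp
qed (simp add: adapted_norm_zero)

lemma G_zero: "G (\<lambda>n. 0) = (\<lambda>n. 0)"
  using G_diff[OF XB_zero XB_zero] by simp

lemma adapted_norm_G:
  assumes "x \<in> XB B"
  shows "adapted_norm (G x) \<le> opnorm G * adapted_norm x"
proof (cases "adapted_norm x = 0")
  case True
  then show ?thesis
    using adapted_norm_eq_0[OF assms] by (simp add: G_zero adapted_norm_zero)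
next
  case False
  have "adapted_norm (G x) / adapted_norm x \<le> opnorm G"
    unfolding onormXB'_def by (rule cSUP_upper[OF assms bdd_above_G])
  with False adapted_norm_nonneg[OF assms] show ?thesis
    by (simp add: divide_le_eq)
qed

text \<open>The zero sequence contributes the quotient \<open>0 / 0 = 0\<close> to the
  supremum.\<close>

lemma opnorm_G_nonneg: "0 \<le> opnorm G"
  using cSUP_upper[OF XB_zero bdd_above_G] unfolding onormXB'_def
  by (simp add: adapted_norm_zero)

lemma adapted_norm_minus_commute:
  "adapted_norm (\<lambda>n. x n - y n) = adapted_norm (\<lambda>n. y n - x n)"
  unfolding normXB'_def comp_diff by (simp add: normXB_def norm_minus_commute)

subsection \<open>Quasi-shadowing\<close>

text \<open>This is Banach's fixed point theorem on the carrier \<open>XB B\<close> with the adapted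
  distance. Completeness is known for \<open>normXB\<close> and is carried over by the equivalence
  of the two norms.\<close>

lemma contraction_fixed_point:
  assumes T: "\<And>x. x \<in> XB B \<Longrightarrow> T x \<in> XB B" and "q < 1"
    and con: "\<And>x y. x \<in> XB B \<Longrightarrow> y \<in> XB B \<Longrightarrow>
      adapted_norm (\<lambda>n. T x n - T y n) \<le> q * adapted_norm (\<lambda>n. x n - y n)"
  obtains z where "z \<in> XB B" "T z = z"
proof -
  \<comment> \<open>\<open>Metric_space\<close> wants a distance that is nonnegative off the carrier, too.\<close>
  define \<rho> where "\<rho> x y = \<bar>adapted_norm (\<lambda>n. x n - y n)\<bar>" for x y
  have \<rho>: "\<rho> x y = adapted_norm (\<lambda>n. x n - y n)" if "x \<in> XB B" "y \<in> XB B" for x y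
    using adapted_norm_nonneg[OF XB_diff[OF that]] by (simp add: \<rho>_def)
  interpret Metric_space "XB B" \<rho>
  proof
    show "\<rho> x y = \<rho> y x" for x y
      using adapted_norm_minus_commute[of x y] by (simp add: \<rho>_def)
    show "\<rho> x y = 0 \<longleftrightarrow> x = y" if "x \<in> XB B" "y \<in> XB B" for x y
      using adapted_norm_eq_0[OF XB_diff[OF that]] by (auto simp: \<rho>[OF that] fun_eq_iff)
    show "\<rho> x z \<le> \<rho> x y + \<rho> y z" if "x \<in> XB B" "y \<in> XB B" "z \<in> XB B" for x y z
      using adapted_norm_triangle[of x y z] that by (simp add: \<rho>)
  qed (simp add: \<rho>_def)
  have mcomplete
    unfolding mcomplete_def
  proof (intro allI impI)
    fix x :: "nat \<Rightarrow> int \<Rightarrow> 'a" assume x: "MCauchy x"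
    then have xB: "x k \<in> XB B" for k by (auto simp: MCauchy_def)
    have "\<exists>K. \<forall>k\<ge>K. \<forall>l\<ge>K. normXB N (\<lambda>n. x k n - x l n) < e" if "e > 0" for e
    proof -
      \<comment> \<open>The half compensates for the factor 2 in
        \<open>normXB_le_adapted\<close>.\<close>
      have "\<exists>K. \<forall>k l. K \<le> k \<longrightarrow> K \<le> l \<longrightarrow> \<rho> (x k) (x l) < e / 2"
        using x half_gt_zero[OF that] unfolding MCauchy_def by blast
      then obtain K where "\<And>k l. k \<ge> K \<Longrightarrow> l \<ge> K \<Longrightarrow> \<rho> (x k) (x l) < e / 2"
        by blast
      then have "adapted_norm (\<lambda>n. x k n - x l n) < e / 2" if "k \<ge> K" "l \<ge> K" for k l
        using that by (simp only: \<rho>[OF xB xB])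
      then have "normXB N (\<lambda>n. x k n - x l n) < e" if "k \<ge> K" "l \<ge> K" for k l
        using normXB_le_adapted[OF XB_diff[OF xB xB], of k l] that by fastforce
      then show ?thesis by blast
    qed
    from XB_complete[OF xB this]
    obtain z where z: "z \<in> XB B" "(\<lambda>k. normXB N (\<lambda>n. x k n - z n)) \<longlonglongrightarrow> 0"
      by blast
    have "(\<lambda>k. (1 + 2 * D) * normXB N (\<lambda>n. x k n - z n)) \<longlonglongrightarrow> 0"
      using tendsto_mult_left[OF z(2)] by simp
    then have "(\<lambda>k. \<rho> (x k) z) \<longlonglongrightarrow> 0"
      by (rule Lim_null_comparison[rotated])
        (simp add: \<rho> xB z(1) adapted_le_normXB XB_diff adapted_norm_nonneg)
    then have "limitin mtopology x z sequentially"
      unfolding limit_metric_sequentially using xB z(1) by (auto simp: LIMSEQ_iff)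
    then show "\<exists>z. limitin mtopology x z sequentially" by blast
  qed
  moreover have "XB B \<noteq> ({} :: (int \<Rightarrow> 'a) set)" using XB_zero by auto
  moreover have "T \<in> XB B \<rightarrow> XB B" using T by auto
  moreover note \<open>q < 1\<close>
  moreover have "\<rho> (T x) (T y) \<le> q * \<rho> x y" if "x \<in> XB B" "y \<in> XB B" for x y
    using con[OF that] by (simp add: \<rho> that T)
  ultimately show thesis
    using that by (rule Banach_fixedpoint_thm)
qed

lemma pseudotrajectory_quasi_shadowed:
  fixes f :: "int \<Rightarrow> 'a \<Rightarrow> 'a"
  assumes c: "c > 0" and f: "\<And>n x y. norm (f n x - f n y) \<le> c * norm (x - y)"
    and small: "4 * c * D * (1 + 2 * D) * opnorm G < 1"
    and y: "pseudotrajectory B N (\<lambda>n x. A n x + f n x) \<delta> y"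
  shows "quasi_shadowed B N P3 (\<lambda>n x. A n x + f n x) (2 * opnorm G * (1 + 2 * D) * \<delta>) y"
proof -
  \<comment> \<open>This is half of the quantity assumed to be less than 1, so
    \<open>q < 1 / 2\<close>. The contraction thus leaves room to absorb
    \<open>1 / 2 * adapted_norm z\<close> in the final estimate.\<close>
  define q where "q = 2 * c * D * (1 + 2 * D) * opnorm G"
  have q: "q < 1 / 2" using small by (simp add: q_def)
  define S where "S z n = A (n - 1) (y (n - 1)) + f (n - 1) (y (n - 1) + su_comp z (n - 1)) - y n"
    for z n
  define r where "r n = y (n + 1) - (A n (y n) + f n (y n))" for n
  have r: "r \<in> XB B" "normXB N r \<le> \<delta>"
    using y unfolding pseudotrajectory_def r_def[abs_def] by auto
  have shift: "(\<lambda>n. x (n - 1)) \<in> XB B" "normXB N (\<lambda>n. x (n - 1)) = normXB N x"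
    if "x \<in> XB B" for x :: "int \<Rightarrow> 'a"
    using shift_mem[of "\<lambda>n. norm (x n)" "-1"] shift_norm[of "\<lambda>n. norm (x n)" "-1"] that
    by (auto simp: XB_def normXB_def)
  \<comment> \<open>At \<open>z = 0\<close> the map returns the negated pseudotrajectory error,
    delayed by one index; shift invariance keeps its norm at most \<open>\<delta>\<close>.\<close>
  have S0: "S (\<lambda>n. 0) = (\<lambda>n. - r (n - 1))"
    by (simp add: S_def r_def su_part_def c_part_def blinfun.zero_right fun_eq_iff)
  then have S0B: "S (\<lambda>n. 0) \<in> XB B" using XB_uminus[OF shift(1)[OF r(1)]] by simp
  have S0n: "normXB N (S (\<lambda>n. 0)) \<le> \<delta>"
    using shift(2)[OF r(1)] r(2) by (simp add: S0 normXB_uminus)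
  have Sdiff: "(\<lambda>n. S z n - S w n) \<in> XB B"
    "normXB N (\<lambda>n. S z n - S w n) \<le> c * normXB N (su_comp (\<lambda>n. z n - w n))"
    if zw: "z \<in> XB B" "w \<in> XB B" for z w
  proof -
    let ?u = "su_comp (\<lambda>n. z n - w n)"
    have u: "?u \<in> XB B" by (intro su_comp_mem XB_diff zw)
    have *: "norm (S z n - S w n) \<le> c * norm (?u (n - 1))" for n
      using f[of "n - 1" "y (n - 1) + su_comp z (n - 1)" "y (n - 1) + su_comp w (n - 1)"]
      by (simp add: S_def comp_diff)
    show "(\<lambda>n. S z n - S w n) \<in> XB B"
      by (rule XB_dominated(1)[OF shift(1)[OF u] *])
    show "normXB N (\<lambda>n. S z n - S w n) \<le> c * normXB N ?u"
      using XB_dominated(2)[OF shift(1)[OF u] *] c by (simp add: shift(2)[OF u])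
  qed
  have SB: "S z \<in> XB B" if "z \<in> XB B" for z
    using XB_add[OF Sdiff(1)[OF that XB_zero] S0B] by simp
  have con: "adapted_norm (\<lambda>n. G (S z) n - G (S w) n) \<le> q * adapted_norm (\<lambda>n. z n - w n)"
    if zw: "z \<in> XB B" "w \<in> XB B" for z w
  proof -
    let ?m = "adapted_norm (\<lambda>n. z n - w n)"
    have "adapted_norm (\<lambda>n. S z n - S w n) \<le> (1 + 2 * D) * normXB N (\<lambda>n. S z n - S w n)"
      by (rule adapted_le_normXB[OF Sdiff(1)[OF zw]])
    also have "\<dots> \<le> (1 + 2 * D) * (c * (2 * D * ?m))"
      using constants_pos c
      by (intro mult_left_mono order_trans[OF Sdiff(2)[OF zw]] normXB_su_comp_le XB_diff zw) auto
    finally have "adapted_norm (\<lambda>n. S z n - S w n) \<le> (1 + 2 * D) * (c * (2 * D * ?m))" .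
    then have "opnorm G * adapted_norm (\<lambda>n. S z n - S w n)
        \<le> opnorm G * ((1 + 2 * D) * (c * (2 * D * ?m)))"
      by (rule mult_left_mono[OF _ opnorm_G_nonneg])
    with adapted_norm_G[OF Sdiff(1)[OF zw]] show ?thesis
      unfolding G_diff[OF SB SB, OF zw] by (simp add: q_def algebra_simps)
  qed
  obtain z where z: "z \<in> XB B" "G (S z) = z"
    by (rule contraction_fixed_point[of "\<lambda>z. G (S z)" q]) (use q con G_mem SB in auto)
  have "adapted_norm z \<le> 2 * opnorm G * (1 + 2 * D) * \<delta>"
  proof -
    have "adapted_norm z \<le> adapted_norm (\<lambda>n. z n - G (S (\<lambda>n. 0)) n)
        + adapted_norm (G (S (\<lambda>n. 0)))"
      using adapted_norm_triangle[OF z(1) G_mem[OF S0B] XB_zero] by simp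
    \<comment> \<open>Here \<open>z\<close> is read as \<open>G (S z)\<close> and compared with the
      image of the zero sequence.\<close>
    also have "adapted_norm (\<lambda>n. z n - G (S (\<lambda>n. 0)) n) \<le> q * adapted_norm z"
      using con[OF z(1) XB_zero] by (simp add: z(2))
    also have "\<dots> \<le> 1 / 2 * adapted_norm z"
      using q by (intro mult_right_mono adapted_norm_nonneg z) simp
    also have "adapted_norm (G (S (\<lambda>n. 0))) \<le> opnorm G * ((1 + 2 * D) * \<delta>)"
      using constants_pos S0n
      by (intro order_trans[OF adapted_norm_G[OF S0B]] mult_left_mono opnorm_G_nonneg
          order_trans[OF adapted_le_normXB[OF S0B]]) auto
    finally show ?thesis by (simp add: mult_ac)
  qed
  \<comment> \<open>\<open>S\<close> at index \<open>n + 1\<close> involves \<open>y n\<close> and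
    \<open>su_comp z n\<close>, which is what \<open>G_equation\<close> at \<open>n\<close>
    requires.\<close>
  moreover have "y (n + 1) + su_comp z (n + 1)
      = A n (y n + su_comp z n) + f n (y n + su_comp z n) + c_comp z (n + 1)" for n
    using G_equation[OF SB[OF z(1)], of n] unfolding z(2)
    by (simp add: S_def blinfun.add_right algebra_simps)
  ultimately show ?thesis
    unfolding quasi_shadowed_def Let_def using z(1) by blast
qed

end

theorem theorem2:
  fixes B :: "(int \<Rightarrow> real) set" and N :: "(int \<Rightarrow> real) \<Rightarrow> real"
    and A P1 P2 P3 :: "int \<Rightarrow> 'a::banach \<Rightarrow>\<^sub>L 'a"
    and f :: "int \<Rightarrow> 'a \<Rightarrow> 'a"
    and D b d c :: real
  assumes "admissible_sequence_space B N"
    and "partial_exp_dichotomy A P1 P2 P3 D b d"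
    and "c > 0"
    and "\<And>n x y. norm (f n x - f n y) \<le> c * norm (x - y)"
    and "4 * c * D * (1 + 2 * D) * onormXB' B N P3 (G_op A P1 P2 P3) < 1"
  shows "lipschitz_quasi_shadowing B N P3 (\<lambda>n x. A n x + f n x)"
proof -
  interpret dichotomous_system B N A P1 P2 P3 D b d
    using assms(1,2) by (simp add: dichotomous_system_def dichotomous_system_axioms_def)
  define M where "M = 2 * opnorm G * (1 + 2 * D)"
  have M: "0 \<le> M"
    unfolding M_def using constants_pos opnorm_G_nonneg by simp
  have shadow: "quasi_shadowed B N P3 (\<lambda>n x. A n x + f n x) \<epsilon> y"
    \<comment> \<open>The Lipschitz constant is \<open>1 / (M + 1)\<close>: only
      \<open>0 \<le> M\<close> is known, and adding 1 keeps the quotient defined and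
      positive.\<close>
    if "\<epsilon> > 0" and y: "pseudotrajectory B N (\<lambda>n x. A n x + f n x) (1 / (M + 1) * \<epsilon>) y" for \<epsilon> y
  proof -
    have "M * (1 / (M + 1) * \<epsilon>) \<le> \<epsilon>"
      using M \<open>\<epsilon> > 0\<close> by (simp add: field_simps)
    moreover have "quasi_shadowed B N P3 (\<lambda>n x. A n x + f n x) (M * (1 / (M + 1) * \<epsilon>)) y"
      using pseudotrajectory_quasi_shadowed[OF assms(3-5) y] by (simp add: M_def)
    ultimately show ?thesis
      unfolding quasi_shadowed_def by (meson order_trans)
  qed
  moreover have "1 / (M + 1) > 0" using M by simp
  ultimately show ?thesis
    unfolding lipschitz_quasi_shadowing_def quasi_shadowing_def
    by (meson mult_pos_pos)
qed

end
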